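(* Every Talbot-admissible datum $u_0\in L^2_{r,0}(\mathbb T)$ satisfies $u_0\in H^s_{r,0}(\mathbb T)$ for every $0\le s<\tfrac12$. Equivalently, $u_0\in H^{1/2-}_{r,0}(\mathbb T):=\bigcap_{0\le s<1/2}H^s_{r,0}(\mathbb T)$.
   Context: $\mathbb T=\mathbb R/2\pi\mathbb Z$. Fourier coefficients: $\widehat f(n)=\frac1{2\pi}\int_0^{2\pi}f(x)e^{-inx}\,dx$. $H^s_{r,0}(\mathbb T)$ is the space of real-valued functions $v$ in the Sobolev space $H^s(\mathbb T)$ with $\widehat v(0)=0$, and $L^2_{r,0}=H^0_{r,0}$. Gauge transform: $\mathcal G(u)=\partial_x\Pi\big(e^{-i\partial_x^{-1}u}\big)$, where $\partial_x^{-1}f=\sum_{n\ne0}\frac1{in}\widehat f(n)e^{inx}$ and $\Pi$ is the projection onto nonnegative Fourier modes. For $s\in\mathbb R$, $\mathfrak h^s$ is the space of complex sequences $z=(z_n)_{n\ge1}$ with $\sum_{n\ge1}n^{2s}|z_n|^2<\infty$. Talbot-admissibility: $u_0\in L^2_{r,0}(\mathbb T)$ is Talbot-admissible if there are finitely many points $a_1,\dots,a_J\in\mathbb T$, complex coefficients $c_1,\dots,c_J$, and a sequence $(\rho_n)_{n\ge1}\in\mathfrak h^{1/2+\varepsilon}$ for some $\varepsilon>0$, such that $\widehat{\mathcal G(u_0)}(n)=\sum_{j=1}^J\frac{c_je^{-ina_j}}{n}+\rho_n$ for all $n\ge1$. *)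

theory Defs
  imports "HOL-Analysis.Analysis"
begin

text \<open>
  Functions on the circle are represented by their \<open>2\<pi>\<close>-periodic lifts to the real line;
  an element of \<open>L\<^sup>2\<close> is given by any of its (Lebesgue measurable) representatives.
\<close>

definition L2_circle :: "(real \<Rightarrow> complex) set" where
  "L2_circle = {f. (\<forall>x. f (x + 2 * pi) = f x) \<and> f \<in> borel_measurable lebesgue \<and>
     set_integrable lebesgue {0..2 * pi} (\<lambda>x. (cmod (f x))\<^sup>2)}"

definition fourier_mode :: "int \<Rightarrow> real \<Rightarrow> complex" where
  "fourier_mode n x = exp (\<i> * of_int n * of_real x)"

definition fourier_coeff :: "(real \<Rightarrow> complex) \<Rightarrow> int \<Rightarrow> complex" where
  "fourier_coeff f n =
     1 / (2 * of_real pi) * (LINT x:{0..2 * pi}|lebesgue. f x * fourier_mode (- n) x)"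

text \<open>
  For \<open>s \<ge> 0\<close>, the only range used here, \<open>H\<^sup>s\<close> is a subspace of \<open>L\<^sup>2\<close>; for \<open>s < 0\<close> this set
  is not the usual Sobolev space of distributions.
\<close>

definition Sobolev :: "real \<Rightarrow> (real \<Rightarrow> complex) set" where
  "Sobolev s = {f \<in> L2_circle.
     (\<lambda>n::int. (1 + (real_of_int n)\<^sup>2) powr s * (cmod (fourier_coeff f n))\<^sup>2) summable_on UNIV}"

definition Sobolev_r0 :: "real \<Rightarrow> (real \<Rightarrow> real) set" where
  "Sobolev_r0 s = {v. (\<lambda>x. complex_of_real (v x)) \<in> Sobolev s \<and>
     fourier_coeff (\<lambda>x. complex_of_real (v x)) 0 = 0}"

abbreviation L2_r0 :: "(real \<Rightarrow> real) set" where
  "L2_r0 \<equiv> Sobolev_r0 0"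

definition Sobolev_half_minus_r0 :: "(real \<Rightarrow> real) set" where
  "Sobolev_half_minus_r0 = (\<Inter>s\<in>{0..<1/2}. Sobolev_r0 s)"

text \<open>The series converges absolutely at every point when \<open>f\<close> is square integrable.\<close>

definition antideriv :: "(real \<Rightarrow> complex) \<Rightarrow> real \<Rightarrow> complex" where
  "antideriv f x =
     (\<Sum>\<^sub>\<infinity>n\<in>UNIV - {0}. 1 / (\<i> * of_int n) * fourier_coeff f n * fourier_mode n x)"

text \<open>
  The derivative in the gauge transform is a distributional one, so it and the projection
  \<open>\<Pi>\<close> are defined on periodic distributions, i.e. functionals on smooth \<open>2\<pi>\<close>-periodic
  complex test functions (values on other functions are irrelevant).  The pairing is bilinear,
  and \<open>distr_of f\<close> is the distribution given by the function \<open>f\<close>.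
\<close>

type_synonym distribution = "(real \<Rightarrow> complex) \<Rightarrow> complex"

definition distr_of :: "(real \<Rightarrow> complex) \<Rightarrow> distribution" where
  "distr_of f \<phi> = (LINT x:{0..2 * pi}|lebesgue. f x * \<phi> x)"

definition distr_deriv :: "distribution \<Rightarrow> distribution" where
  "distr_deriv T \<phi> = - T (\<lambda>x. vector_derivative \<phi> (at x))"

definition distr_fourier_coeff :: "distribution \<Rightarrow> int \<Rightarrow> complex" where
  "distr_fourier_coeff T n = 1 / (2 * of_real pi) * T (fourier_mode (- n))"

lemma distr_fourier_coeff_distr_of: "distr_fourier_coeff (distr_of f) n = fourier_coeff f n"
  by (simp add: distr_fourier_coeff_def distr_of_def fourier_coeff_def)

text \<open>The distribution \<open>\<Sum>n\<ge>0. T\<^sub>n e\<^bsup>inx\<^esup>\<close>, where \<open>T\<^sub>n\<close> are the Fourier coefficients of \<open>T\<close>.\<close>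

definition distr_proj :: "distribution \<Rightarrow> distribution" where
  "distr_proj T \<phi> = (\<Sum>\<^sub>\<infinity>n\<in>{0..}. distr_fourier_coeff T n * distr_of (fourier_mode n) \<phi>)"

definition gauge_transform :: "(real \<Rightarrow> real) \<Rightarrow> distribution" where
  "gauge_transform u = distr_deriv (distr_proj (distr_of
     (\<lambda>x. exp (- \<i> * antideriv (\<lambda>y. complex_of_real (u y)) x))))"

text \<open>Sequences are indexed by \<open>n \<ge> 1\<close>; the entry at \<open>0\<close> is ignored.\<close>

definition weighted_l2 :: "real \<Rightarrow> (nat \<Rightarrow> complex) set" where
  "weighted_l2 s = {z. (\<lambda>n. real n powr (2 * s) * (cmod (z n))\<^sup>2) summable_on {1..}}"

definition Talbot_admissible :: "(real \<Rightarrow> real) \<Rightarrow> bool" where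
  "Talbot_admissible u \<longleftrightarrow> u \<in> L2_r0 \<and>
     (\<exists>(J::nat) (a::nat \<Rightarrow> real) (c::nat \<Rightarrow> complex) (\<epsilon>::real) (\<rho>::nat \<Rightarrow> complex).
        \<epsilon> > 0 \<and> \<rho> \<in> weighted_l2 (1/2 + \<epsilon>) \<and>
        (\<forall>n\<ge>1. distr_fourier_coeff (gauge_transform u) (int n) =
           (\<Sum>j=1..J. c j * exp (- \<i> * of_nat n * of_real (a j)) / of_nat n) + \<rho> n))"

end

theory Submission
  imports Defs
begin

text \<open>
  Let \<open>F\<close> be the antiderivative of the real datum \<open>u\<close>, and \<open>w = e\<^bsup>-iF\<^esup>\<close>. For \<open>n \<ge> 1\<close> the
  coefficient of the gauge transform is \<open>in\<close> times that of \<open>w\<close>, so admissibility says that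
  \<open>\<Pi> w\<close> has coefficients \<open>O(n\<^bsup>-2\<^esup>)\<close> up to a remainder \<open>O(\<bar>\<rho>\<^sub>n\<bar>/n)\<close>, and hence that \<open>\<Pi> w\<close>
  is in \<open>H\<^bsup>1+s\<^esup>\<close> for every \<open>s < 1/2\<close> (\<open>Talbot_profile_weighted_l2\<close>). It remains to pass from
  one half of the spectrum of \<open>w\<close> to the whole function \<open>u\<close>.

  As \<open>u\<close> is real with mean zero, \<open>F = f + cnj f\<close> with \<open>f\<close> analytic (only positive modes).
  Put \<open>A = e\<^bsup>if\<^esup>\<close> and \<open>B = e\<^bsup>-if\<^esup> = 1/A\<close>; both are analytic, and \<open>w = B \<cdot> cnj A\<close>
  (\<open>gauge_transform_coeff\<close>). Multiplying by \<open>cnj B\<close> gives \<open>B = w \<cdot> cnj B\<close>. The negative modes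
  of \<open>w\<close> remain negative when multiplied by \<open>cnj B\<close>, so \<open>B = \<Pi> ((\<Pi> w) \<cdot> cnj B)\<close>
  (\<open>toeplitz_reproduces\<close>): \<open>B\<close> depends on the known half of \<open>w\<close> only. In coefficients,
  \<open>b\<^sub>n\<close> is a sum over \<open>j \<ge> 0\<close> of coefficients of \<open>w\<close> at \<open>n + j \<ge> n\<close> against \<open>cnj b\<^sub>j\<close>. As
  \<open>b\<close> is absolutely summable and \<open>n\<^bsup>1+s\<^esup> \<le> (n + j)\<^bsup>1+s\<^esup>\<close>, Young's inequality shows that \<open>B\<close>
  is in \<open>H\<^bsup>1+s\<^esup>\<close>.

  Finally \<open>f' = i A B'\<close>, where \<open>B'\<close> is in \<open>H\<^sup>s\<close> and \<open>A\<close> in \<open>H\<^sup>1\<close>. As \<open>s < 1/2\<close>, the sequence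
  \<open>n\<^sup>s \<bar>a\<^sub>n\<bar>\<close> is summable, so the product is in \<open>H\<^sup>s\<close> (\<open>regularity_from_projection\<close>), and
  \<open>u = f' + cnj f'\<close>.

  Everything takes place on coefficient sequences: \<open>f\<close>, \<open>A\<close> and \<open>B\<close> are formal power series
  with absolutely summable coefficients, so that \<open>A\<close> and \<open>B\<close> are formal compositions whose
  product and derivatives are purely algebraic.
\<close>

unbundle no vec_syntax
unbundle fps_syntax

section \<open>Square summable sequences\<close>

text \<open>
  Minkowski's inequality: an \<open>\<ell>\<^sup>1\<close> combination of sequences \<open>X j\<close> that are
  uniformly bounded in \<open>\<ell>\<^sup>2\<close> is in \<open>\<ell>\<^sup>2\<close>. Both forms of Young's inequality
  \<open>\<ell>\<^sup>1 * \<ell>\<^sup>2 \<subseteq> \<ell>\<^sup>2\<close> needed below are the cases where \<open>X j\<close> is a left or a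
  right shift of one fixed sequence.
\<close>

lemma summable_sq_minkowski:
  fixes y :: "nat \<Rightarrow> real" and X :: "nat \<Rightarrow> nat \<Rightarrow> real"
  assumes y: "\<And>j. 0 \<le> y j" "summable y"
    and X: "\<And>j N. (\<Sum>n<N. (X j n)\<^sup>2) \<le> S"
  shows "summable (\<lambda>j. y j * X j n)" and "summable (\<lambda>n. (\<Sum>j. y j * X j n)\<^sup>2)"
proof -
  have pt: "\<bar>X j n\<bar> \<le> sqrt S" for j n
  proof -
    have "(X j n)\<^sup>2 \<le> (\<Sum>n<Suc n. (X j n)\<^sup>2)" by (simp add: sum_nonneg)
    also have "\<dots> \<le> S" by (rule X)
    finally show ?thesis by (metis real_sqrt_abs real_sqrt_le_iff)
  qed
  show sm: "summable (\<lambda>j. y j * X j n)" for n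
  proof (rule summable_comparison_test)
    show "\<exists>N. \<forall>j\<ge>N. norm (y j * X j n) \<le> y j * sqrt S"
      using y pt by (auto simp: abs_mult intro!: mult_left_mono)
    show "summable (\<lambda>j. y j * sqrt S)" by (rule summable_mult2[OF y(2)])
  qed
  define Y where "Y = suminf y"
  have fin: "L2_set (\<lambda>n. \<Sum>j<M. y j * X j n) {..<N} \<le> (\<Sum>j<M. y j) * sqrt S" for M N
  proof (induction M)
    case (Suc M)
    have one: "L2_set (\<lambda>n. y M * X M n) {..<N} \<le> y M * sqrt S"
      unfolding L2_set_right_distrib[OF y(1), symmetric] using y(1) X
      by (intro mult_left_mono) (simp_all add: L2_set_def)
    have "L2_set (\<lambda>n. \<Sum>j<Suc M. y j * X j n) {..<N}
        \<le> L2_set (\<lambda>n. \<Sum>j<M. y j * X j n) {..<N} + L2_set (\<lambda>n. y M * X M n) {..<N}"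
      using L2_set_triangle_ineq[of "\<lambda>n. \<Sum>j<M. y j * X j n" "\<lambda>n. y M * X M n"] by simp
    then show ?case using Suc one by (simp add: algebra_simps)
  qed (simp add: L2_set_def)
  have bound: "(\<Sum>n<N. (\<Sum>j. y j * X j n)\<^sup>2) \<le> (Y * sqrt S)\<^sup>2" for N
  proof (rule LIMSEQ_le_const2)
    show "(\<lambda>M. \<Sum>n<N. (\<Sum>j<M. y j * X j n)\<^sup>2) \<longlonglongrightarrow> (\<Sum>n<N. (\<Sum>j. y j * X j n)\<^sup>2)"
      by (intro tendsto_sum tendsto_power summable_LIMSEQ sm)
    have "(\<Sum>n<N. (\<Sum>j<M. y j * X j n)\<^sup>2) \<le> (Y * sqrt S)\<^sup>2" for M
    proof -
      have "L2_set (\<lambda>n. \<Sum>j<M. y j * X j n) {..<N} \<le> Y * sqrt S"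
      proof -
        have "(\<Sum>j<M. y j) \<le> Y" unfolding Y_def using y by (intro sum_le_suminf) auto
        moreover have "0 \<le> S" using X[of 0 0] by simp
        ultimately show ?thesis using fin[of M N]
          by (meson mult_right_mono order_trans real_sqrt_ge_zero)
      qed
      then have "(L2_set (\<lambda>n. \<Sum>j<M. y j * X j n) {..<N})\<^sup>2 \<le> (Y * sqrt S)\<^sup>2"
        by (intro power_mono) auto
      then show ?thesis by (simp add: L2_set_def sum_nonneg)
    qed
    then show "\<exists>M0. \<forall>M\<ge>M0. (\<Sum>n<N. (\<Sum>j<M. y j * X j n)\<^sup>2) \<le> (Y * sqrt S)\<^sup>2" by blast
  qed
  show "summable (\<lambda>n. (\<Sum>j. y j * X j n)\<^sup>2)"
    by (rule bounded_imp_summable[of _ "(Y * sqrt S)\<^sup>2"]) (use bound[of "Suc _"] in \<open>auto simp: lessThan_Suc_atMost\<close>)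
qed

lemma summable_sq_correlation:
  fixes x y :: "nat \<Rightarrow> real"
  assumes "summable (\<lambda>n. (x n)\<^sup>2)" "\<And>n. 0 \<le> y n" "summable y"
  shows "summable (\<lambda>j. y j * x (n + j))" and "summable (\<lambda>n. (\<Sum>j. y j * x (n + j))\<^sup>2)"
proof -
  have "(\<Sum>n<N. (x (n + j))\<^sup>2) \<le> (\<Sum>n. (x n)\<^sup>2)" for j N
  proof -
    have "(\<Sum>n<N. (x (n + j))\<^sup>2) = (\<Sum>n\<in>(\<lambda>n. n + j) ` {..<N}. (x n)\<^sup>2)"
      by (subst sum.reindex) (auto simp: inj_on_def)
    also have "\<dots> \<le> (\<Sum>n. (x n)\<^sup>2)" by (rule sum_le_suminf) (use assms in auto)
    finally show ?thesis .
  qed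
  note * = summable_sq_minkowski[OF assms(2,3), of "\<lambda>j n. x (n + j)", OF this]
  show "summable (\<lambda>j. y j * x (n + j))" and "summable (\<lambda>n. (\<Sum>j. y j * x (n + j))\<^sup>2)"
    using * by auto
qed

lemma summable_sq_convolution:
  fixes x y :: "nat \<Rightarrow> real"
  assumes "summable (\<lambda>n. (x n)\<^sup>2)" "\<And>n. 0 \<le> y n" "summable y"
  shows "summable (\<lambda>n. (\<Sum>j\<le>n. y j * x (n - j))\<^sup>2)"
proof -
  have *: "(\<Sum>n<N. (if j \<le> n then x (n - j) else 0)\<^sup>2) \<le> (\<Sum>n. (x n)\<^sup>2)" for j N
  proof -
    have "(\<Sum>n<N. (if j \<le> n then x (n - j) else 0)\<^sup>2) = (\<Sum>n\<in>{j..<N}. (x (n - j))\<^sup>2)"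
      by (rule sum.mono_neutral_cong_right) auto
    also have "\<dots> = (\<Sum>n\<in>(\<lambda>n. n - j) ` {j..<N}. (x n)\<^sup>2)"
      by (subst sum.reindex) (auto simp: inj_on_def)
    also have "\<dots> \<le> (\<Sum>n. (x n)\<^sup>2)" by (rule sum_le_suminf) (use assms in auto)
    finally show ?thesis .
  qed
  have eq: "(\<Sum>j. y j * (if j \<le> n then x (n - j) else 0)) = (\<Sum>j\<le>n. y j * x (n - j))" for n
    by (subst suminf_finite[of "{..n}"]) auto
  show ?thesis
    using summable_sq_minkowski(2)[OF assms(2,3), of "\<lambda>j n. if j \<le> n then x (n - j) else 0", OF *]
    by (simp add: eq)
qed

lemma summable_sq_le:
  fixes x y :: "nat \<Rightarrow> real"
  assumes "summable (\<lambda>n. (y n)\<^sup>2)" "\<And>n. \<bar>x n\<bar> \<le> y n"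
  shows "summable (\<lambda>n. (x n)\<^sup>2)"
proof (rule summable_comparison_test[OF _ assms(1)])
  have "(x n)\<^sup>2 \<le> (y n)\<^sup>2" for n by (rule abs_le_square_iff[THEN iffD1]) (use assms(2)[of n] in auto)
  then show "\<exists>N. \<forall>n\<ge>N. norm ((x n)\<^sup>2) \<le> (y n)\<^sup>2" by auto
qed

lemma summable_sq_add:
  fixes x y :: "nat \<Rightarrow> real"
  assumes "summable (\<lambda>n. (x n)\<^sup>2)" "summable (\<lambda>n. (y n)\<^sup>2)"
  shows "summable (\<lambda>n. (x n + y n)\<^sup>2)"
proof (rule summable_comparison_test)
  have "(x n + y n)\<^sup>2 \<le> 2 * (x n)\<^sup>2 + 2 * (y n)\<^sup>2" for n
    using zero_le_power2[of "x n - y n"] by (simp add: power2_eq_square algebra_simps)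
  then show "\<exists>N. \<forall>n\<ge>N. norm ((x n + y n)\<^sup>2) \<le> 2 * (x n)\<^sup>2 + 2 * (y n)\<^sup>2" by auto
  show "summable (\<lambda>n. 2 * (x n)\<^sup>2 + 2 * (y n)\<^sup>2)" using assms by (intro summable_add summable_mult)
qed

lemma summable_sq_powr:
  assumes "s < 1/2"
  shows "summable (\<lambda>n. (real n powr (s - 1))\<^sup>2)"
proof -
  have "(real n powr (s - 1))\<^sup>2 = real n powr (2 * s - 2)" for n
    by (simp add: power2_eq_square powr_add[symmetric])
  then show ?thesis using assms summable_real_powr_iff[of "2 * s - 2"] by simp
qed

text \<open>
  Write \<open>n\<^sup>s x\<^sub>n\<close> as \<open>n\<^bsup>s-1\<^esup> \<cdot> n x\<^sub>n\<close>; the first factor is square summable exactly when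
  \<open>s < 1/2\<close>. This is the embedding of \<open>H\<^sup>1\<close> into the Wiener algebra with weight \<open>n\<^sup>s\<close>.
\<close>

lemma summable_powr_mult:
  fixes x :: "nat \<Rightarrow> real"
  assumes s: "s < 1/2" and x: "summable (\<lambda>n. (real n * x n)\<^sup>2)"
  shows "summable (\<lambda>n. real n powr s * \<bar>x n\<bar>)"
proof (rule summable_comparison_test)
  have "real n powr s * \<bar>x n\<bar> \<le> (real n powr (s - 1))\<^sup>2 + (real n * x n)\<^sup>2" for n
  proof (cases "n = 0")
    case False
    define p q where "p = real n powr (s - 1)" and "q = \<bar>real n * x n\<bar>"
    have "real n powr s = p * real n" using False powr_mult_base[of "real n" "s - 1"] by (simp add: p_def mult.commute)
    then have "real n powr s * \<bar>x n\<bar> = p * q" by (simp add: q_def abs_mult)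
    also have "\<dots> \<le> p\<^sup>2 + q\<^sup>2" using zero_le_power2[of "p - q"] zero_le_power2[of p] zero_le_power2[of q]
      unfolding power2_diff by linarith
    finally show ?thesis by (simp add: p_def q_def)
  qed simp
  then show "\<exists>N. \<forall>n\<ge>N. norm (real n powr s * \<bar>x n\<bar>) \<le> (real n powr (s - 1))\<^sup>2 + (real n * x n)\<^sup>2"
    by (auto simp: abs_mult)
  show "summable (\<lambda>n. (real n powr (s - 1))\<^sup>2 + (real n * x n)\<^sup>2)"
    by (intro summable_add summable_sq_powr s x)
qed

lemma summable_of_summable_sq_weighted:
  fixes x :: "nat \<Rightarrow> complex"
  assumes "summable (\<lambda>n. (real n * cmod (x n))\<^sup>2)"
  shows "summable (\<lambda>n. cmod (x n))"
proof (rule summable_comparison_test)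
  show "summable (\<lambda>n. real n powr 0 * \<bar>cmod (x n)\<bar>)"
    by (rule summable_powr_mult) (use assms in auto)
  show "\<exists>N. \<forall>n\<ge>N. norm (cmod (x n)) \<le> real n powr 0 * \<bar>cmod (x n)\<bar>"
    by (intro exI[of _ 1]) auto
qed

section \<open>Exponentials of absolutely summable power series\<close>

text \<open>
  Fubini's theorem for double series; its integrability hypothesis is the convergence of the
  iterated sum of absolute values by rows.
\<close>

lemma double_series:
  fixes d :: "nat \<Rightarrow> nat \<Rightarrow> complex"
  assumes row: "\<And>k. summable (\<lambda>n. cmod (d k n))"
    and rows: "summable (\<lambda>k. \<Sum>n. cmod (d k n))"
  shows "summable (\<lambda>n. cmod (\<Sum>k. d k n))"
    and "(\<Sum>n. \<Sum>k. d k n) = (\<Sum>k. \<Sum>n. d k n)"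
proof -
  have infs: "infsum f UNIV = suminf f" if "summable (\<lambda>n. norm (f n))"
    for f :: "nat \<Rightarrow> 'b::banach"
    using infsumI[OF norm_summable_imp_has_sum[OF that]] summable_norm_cancel[OF that]
    by (simp add: summable_sums)
  have son: "(\<lambda>n. norm (f n)) summable_on UNIV \<longleftrightarrow> summable (\<lambda>n. norm (f n))"
    for f :: "nat \<Rightarrow> 'b::real_normed_vector"
    by (rule summable_on_UNIV_nonneg_real_iff) simp
  have rowi: "(\<Sum>\<^sub>\<infinity>n. norm (d k n)) = (\<Sum>n. cmod (d k n))" for k
    using infs[of "\<lambda>n. norm (d k n)"] row[of k] by simp
  have abs: "(\<lambda>kn. norm (case kn of (k, n) \<Rightarrow> d k n)) summable_on UNIV \<times> UNIV"
    unfolding Infinite_Sum.abs_summable_on_Sigma_iff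
    using row rows son[of "\<lambda>k. \<Sum>n. cmod (d k n)"] by (simp add: son rowi suminf_nonneg)
  then have abs': "(\<lambda>nk. norm (case nk of (n, k) \<Rightarrow> d k n)) summable_on UNIV \<times> UNIV"
    by (subst (asm) product_swap[symmetric], subst (asm) summable_on_reindex)
       (auto simp: o_def case_prod_unfold)
  have col: "summable (\<lambda>k. cmod (d k n))" for n
    using abs' unfolding Infinite_Sum.abs_summable_on_Sigma_iff by (simp add: son)
  have coli: "(\<Sum>\<^sub>\<infinity>k. norm (d k n)) = (\<Sum>k. cmod (d k n))" for n
    using infs[of "\<lambda>k. norm (d k n)"] col[of n] by simp
  have cols: "summable (\<lambda>n. \<Sum>k. cmod (d k n))"
    using abs' son[of "\<lambda>n. \<Sum>k. cmod (d k n)"] col unfolding Infinite_Sum.abs_summable_on_Sigma_iff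
    by (simp add: coli suminf_nonneg)
  show *: "summable (\<lambda>n. cmod (\<Sum>k. d k n))"
    by (rule summable_comparison_test[OF _ cols]) (simp add: summable_norm col)
  have **: "summable (\<lambda>k. cmod (\<Sum>n. d k n))"
    by (rule summable_comparison_test[OF _ rows]) (simp add: summable_norm row)
  have "(\<Sum>\<^sub>\<infinity>k. \<Sum>\<^sub>\<infinity>n. d k n) = (\<Sum>\<^sub>\<infinity>n. \<Sum>\<^sub>\<infinity>k. d k n)"
    by (rule infsum_swap_banach[OF Infinite_Sum.abs_summable_summable[OF abs]])
  then show "(\<Sum>n. \<Sum>k. d k n) = (\<Sum>k. \<Sum>n. d k n)"
    by (simp add: infs row col * **)
qed

text \<open>
  Power series with absolutely summable coefficients form a Banach algebra under the
  \<open>\<ell>\<^sup>1\<close> norm, and evaluation at a point of the closed disc is multiplicative on it, by the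
  Cauchy product. The bound on the norm of a power is what makes the exponential series
  of the next lemma converge in this algebra, including on the boundary circle.
\<close>

lemma fps_power_wiener:
  fixes g :: "complex fps"
  assumes g: "summable (\<lambda>n. cmod (g $ n))" and z: "cmod z \<le> 1"
  shows "summable (\<lambda>n. cmod (g ^ k $ n))"
    and "(\<Sum>n. cmod (g ^ k $ n)) \<le> (\<Sum>n. cmod (g $ n)) ^ k"
    and "(\<lambda>n. g ^ k $ n * z ^ n) sums (\<Sum>n. g $ n * z ^ n) ^ k"
proof -
  have sz: "summable (\<lambda>n. cmod (h $ n * z ^ n))" if "summable (\<lambda>n. cmod (h $ n))" for h
    by (rule summable_comparison_test[OF _ that])
       (use z in \<open>auto simp: norm_mult norm_power power_le_one mult_left_le\<close>)
  have "summable (\<lambda>n. cmod (g ^ k $ n)) \<and> (\<Sum>n. cmod (g ^ k $ n)) \<le> (\<Sum>n. cmod (g $ n)) ^ k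
    \<and> (\<lambda>n. g ^ k $ n * z ^ n) sums (\<Sum>n. g $ n * z ^ n) ^ k"
  proof (induction k)
    case 0
    have "(\<lambda>n. (1 :: complex fps) $ n * z ^ n) sums 1" and "(\<lambda>n. cmod ((1 :: complex fps) $ n)) sums 1"
      using sums_If_finite_set[of "{0}" "\<lambda>_. 1 :: complex"] sums_If_finite_set[of "{0}" "\<lambda>_. 1 :: real"]
      by (auto simp: if_distrib if_distribR cong: if_cong)
    then show ?case by (auto simp: sums_iff)
  next
    case (Suc k)
    then have k: "summable (\<lambda>n. cmod (g ^ k $ n))"
        "(\<Sum>n. cmod (g ^ k $ n)) \<le> (\<Sum>n. cmod (g $ n)) ^ k"
        "(\<lambda>n. g ^ k $ n * z ^ n) sums (\<Sum>n. g $ n * z ^ n) ^ k" by auto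
    have nth: "g ^ Suc k $ n = (\<Sum>i\<le>n. g $ i * g ^ k $ (n - i))" for n
      by (simp add: fps_mult_nth atMost_atLeast0)
    define c where "c n = (\<Sum>i\<le>n. cmod (g $ i) * cmod (g ^ k $ (n - i)))" for n
    have c: "c sums ((\<Sum>n. cmod (g $ n)) * (\<Sum>n. cmod (g ^ k $ n)))"
      unfolding c_def by (rule Cauchy_product_sums) (use g k in auto)
    have le: "cmod (g ^ Suc k $ n) \<le> c n" for n
      unfolding nth c_def by (rule order_trans[OF norm_sum]) (simp add: norm_mult)
    have sm: "summable (\<lambda>n. cmod (g ^ Suc k $ n))"
      by (rule summable_comparison_test[OF _ sums_summable[OF c]]) (use le in auto)
    have "(\<Sum>n. cmod (g ^ Suc k $ n)) \<le> suminf c" by (rule suminf_le[OF le sm sums_summable[OF c]])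
    also have "\<dots> = (\<Sum>n. cmod (g $ n)) * (\<Sum>n. cmod (g ^ k $ n))" using c by (simp add: sums_iff)
    also have "\<dots> \<le> (\<Sum>n. cmod (g $ n)) * (\<Sum>n. cmod (g $ n)) ^ k"
      by (rule mult_left_mono[OF k(2)]) (simp add: suminf_nonneg g)
    finally have bd: "(\<Sum>n. cmod (g ^ Suc k $ n)) \<le> (\<Sum>n. cmod (g $ n)) ^ Suc k" by simp
    have "(\<lambda>n. \<Sum>i\<le>n. (g $ i * z ^ i) * (g ^ k $ (n - i) * z ^ (n - i))) sums
        ((\<Sum>n. g $ n * z ^ n) * (\<Sum>n. g ^ k $ n * z ^ n))"
      by (rule Cauchy_product_sums[OF sz[OF g] sz[OF k(1)]])
    moreover have "(\<Sum>i\<le>n. (g $ i * z ^ i) * (g ^ k $ (n - i) * z ^ (n - i))) = g ^ Suc k $ n * z ^ n" for n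
    proof -
      have "(g $ i * z ^ i) * (g ^ k $ (n - i) * z ^ (n - i)) = g $ i * g ^ k $ (n - i) * z ^ n"
        if "i \<le> n" for i
        using that power_add[of z i "n - i"] by simp
      then show ?thesis unfolding nth sum_distrib_right by (intro sum.cong) auto
    qed
    ultimately have "(\<lambda>n. g ^ Suc k $ n * z ^ n) sums (\<Sum>n. g $ n * z ^ n) ^ Suc k"
      using k(3) by (simp add: sums_iff)
    then show ?case using sm bd by blast
  qed
  then show "summable (\<lambda>n. cmod (g ^ k $ n))"
    and "(\<Sum>n. cmod (g ^ k $ n)) \<le> (\<Sum>n. cmod (g $ n)) ^ k"
    and "(\<lambda>n. g ^ k $ n * z ^ n) sums (\<Sum>n. g $ n * z ^ n) ^ k" by auto
qed

text \<open>
  Expanding the exponential gives a double series dominated by \<open>exp (\<bar>c\<bar> \<parallel>g\<parallel>\<^sub>1)\<close>;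
  summing it by columns gives the coefficients of the formal composition, by rows the
  exponential of the value of \<open>g\<close>.
\<close>

lemma fps_exp_compose_wiener:
  fixes g :: "complex fps"
  assumes g: "summable (\<lambda>n. cmod (g $ n))" "g $ 0 = 0"
  shows "summable (\<lambda>n. cmod ((fps_exp c oo g) $ n))"
    and "cmod z \<le> 1 \<Longrightarrow> (\<Sum>n. (fps_exp c oo g) $ n * z ^ n) = exp (c * (\<Sum>n. g $ n * z ^ n))"
proof -
  define e where "e k = fps_exp c $ k" for k
  define G where "G = (\<Sum>n. cmod (g $ n))"
  have nth: "(\<Sum>k. e k * g ^ k $ n) = (fps_exp c oo g) $ n" for n
    unfolding fps_compose_nth e_def
    by (rule suminf_finite) (use startsby_zero_power_prefix[OF g(2)] in auto)
  have ee: "summable (\<lambda>k. cmod (e k) * r ^ k)" for r :: real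
  proof -
    have "cmod (e k) * r ^ k = inverse (fact k) * (cmod c * r) ^ k" for k
      by (simp add: e_def norm_divide norm_power power_mult_distrib field_simps)
    then show ?thesis using summable_exp[of "cmod c * r"] by simp
  qed
  have ex: "(\<lambda>k. e k * t ^ k) sums exp (c * t)" for t
    using exp_converges[of "c * t"]
    by (simp add: e_def power_mult_distrib scaleR_conv_of_real field_simps)
  have main: "summable (\<lambda>n. cmod ((fps_exp c oo g) $ n * z ^ n)) \<and>
     (\<Sum>n. (fps_exp c oo g) $ n * z ^ n) = exp (c * (\<Sum>n. g $ n * z ^ n))" if z: "cmod z \<le> 1" for z
  proof -
    note pw = fps_power_wiener[OF g(1) z]
    define d where "d k n = e k * (g ^ k $ n * z ^ n)" for k n
    have dle: "cmod (d k n) \<le> cmod (e k) * cmod (g ^ k $ n)" for k n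
      using z by (simp add: d_def norm_mult norm_power mult_left_mono mult_left_le power_le_one)
    have row: "summable (\<lambda>n. cmod (d k n))" for k
      by (rule summable_comparison_test[OF _ summable_mult[OF pw(1)]]) (use dle in auto)
    have "(\<Sum>n. cmod (d k n)) \<le> cmod (e k) * G ^ k" for k
    proof -
      have "(\<Sum>n. cmod (d k n)) \<le> (\<Sum>n. cmod (e k) * cmod (g ^ k $ n))"
        by (rule suminf_le[OF dle row summable_mult[OF pw(1)]])
      also have "\<dots> \<le> cmod (e k) * G ^ k"
        using pw(2)[of k] by (simp add: suminf_mult[OF pw(1)] G_def mult_left_mono)
      finally show ?thesis .
    qed
    then have rows: "summable (\<lambda>k. \<Sum>n. cmod (d k n))"
      by (intro summable_comparison_test[OF _ ee[of G]]) (auto simp: suminf_nonneg row)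
    have dk: "(\<Sum>n. d k n) = e k * (\<Sum>n. g $ n * z ^ n) ^ k" for k
      using sums_mult[OF pw(3)[of k], of "e k"] by (simp add: d_def sums_iff)
    have dn: "(\<Sum>k. d k n) = (fps_exp c oo g) $ n * z ^ n" for n
    proof -
      have "summable (\<lambda>k. e k * g ^ k $ n)"
        by (rule summable_finite[of "{..n}"]) (use startsby_zero_power_prefix[OF g(2)] in auto)
      then have "(\<Sum>k. e k * g ^ k $ n * z ^ n) = (fps_exp c oo g) $ n * z ^ n"
        by (simp add: suminf_mult2[symmetric] nth)
      then show ?thesis by (simp add: d_def mult.assoc)
    qed
    show ?thesis using double_series[OF row rows] ex[of "\<Sum>n. g $ n * z ^ n"]
      by (simp add: dk dn sums_iff)
  qed
  show "summable (\<lambda>n. cmod ((fps_exp c oo g) $ n))" using main[of 1] by simp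
  show "cmod z \<le> 1 \<Longrightarrow> (\<Sum>n. (fps_exp c oo g) $ n * z ^ n) = exp (c * (\<Sum>n. g $ n * z ^ n))"
    using main[of z] by simp
qed

lemma fps_exp_compose_deriv:
  fixes g :: "complex fps"
  assumes "g $ 0 = 0"
  shows "fps_deriv (fps_exp c oo g) = fps_const c * (fps_exp c oo g) * fps_deriv g"
proof -
  have "fps_deriv (fps_exp c oo g) = ((fps_const c * fps_exp c) oo g) * fps_deriv g"
    using fps_compose_deriv[OF assms, of "fps_exp c"] by simp
  then show ?thesis by (simp only: fps_compose_mult_distrib[OF assms] fps_const_compose)
qed

lemma fps_exp_compose_inverse:
  fixes g :: "complex fps"
  assumes "g $ 0 = 0"
  shows "(fps_exp c oo g) * (fps_exp (- c) oo g) = 1"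
proof -
  have "fps_exp c * fps_exp (- c) = 1"
    using fps_exp_add_mult[of c "- c"] by simp
  then show ?thesis by (simp only: fps_compose_mult_distrib[OF assms, symmetric] fps_compose_1)
qed

section \<open>Regularity from the nonnegative modes\<close>

text \<open>
  With \<open>A\<close>, \<open>B = 1/A\<close> the functions with coefficients \<open>a\<close>, \<open>b\<close>, the inner sums are the
  Fourier coefficients of \<open>w = B \<cdot> cnj A\<close>, and the claim is the identity
  \<open>B = \<Pi> ((\<Pi> w) \<cdot> cnj B)\<close> between coefficients of index \<open>n \<ge> 0\<close>. Indeed
  \<open>w \<cdot> cnj B = B\<close>, and the negative modes of \<open>w\<close> stay negative after multiplication by
  the antianalytic \<open>cnj B\<close>. On coefficients this is a regrouping of the double sum by
  \<open>l = j + k\<close>, where the inner sum becomes a coefficient of \<open>a * b = 1\<close>.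
\<close>

lemma toeplitz_reproduces:
  fixes a b :: "complex fps"
  assumes a: "summable (\<lambda>n. cmod (a $ n))" and b: "summable (\<lambda>n. cmod (b $ n))"
    and ab: "a * b = 1"
  shows "b $ n = (\<Sum>j. (\<Sum>k. b $ (n + j + k) * cnj (a $ k)) * cnj (b $ j))"
proof -
  define d where "d j l = (if j \<le> l then b $ (n + l) * cnj (a $ (l - j)) * cnj (b $ j) else 0)" for j l
  define M where "M = (\<Sum>k. cmod (b $ k))"
  define A where "A = (\<Sum>k. cmod (a $ k))"
  have M: "cmod (b $ k) \<le> M" for k
    unfolding M_def using sum_le_suminf[OF b, of "{k}"] by simp
  define h where "h j k = b $ (n + j + k) * cnj (a $ k) * cnj (b $ j)" for j k
  have hle: "cmod (h j k) \<le> M * cmod (b $ j) * cmod (a $ k)" for j k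
    using mult_right_mono[OF M, of "cmod (b $ j) * cmod (a $ k)" "n + j + k"]
    by (simp add: h_def norm_mult mult_ac)
  have hs: "summable (\<lambda>k. cmod (h j k))" for j
    by (rule summable_comparison_test[OF _ summable_mult[OF a]]) (use hle in auto)
  have shift: "d j (k + j) = h j k" for j k by (simp add: d_def h_def add.commute add.left_commute)
  have zero: "(\<Sum>l<j. f (d j l)) = 0" if "f 0 = 0" for f :: "complex \<Rightarrow> 'b::comm_monoid_add" and j
    using that by (intro sum.neutral) (auto simp: d_def)
  have row: "summable (\<lambda>l. cmod (d j l))" for j
    by (subst summable_iff_shift[symmetric, of _ j]) (simp add: shift hs)
  have rowsum: "(\<Sum>l. d j l) = (\<Sum>k. h j k)" for j
    using suminf_split_initial_segment[OF summable_norm_cancel[OF row[of j]], of j]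
    by (simp add: shift zero[of "\<lambda>x. x"])
  have "(\<Sum>l. cmod (d j l)) = (\<Sum>k. cmod (h j k))" for j
    using suminf_split_initial_segment[OF row[of j], of j] by (simp add: shift zero)
  moreover have "(\<Sum>k. cmod (h j k)) \<le> M * A * cmod (b $ j)" for j
  proof -
    have "(\<Sum>k. cmod (h j k)) \<le> (\<Sum>k. M * cmod (b $ j) * cmod (a $ k))"
      by (rule suminf_le[OF hle hs summable_mult[OF a]])
    also have "\<dots> = M * A * cmod (b $ j)" unfolding suminf_mult[OF a] A_def by (simp only: mult_ac)
    finally show ?thesis .
  qed
  ultimately have rows: "summable (\<lambda>j. \<Sum>l. cmod (d j l))"
    by (intro summable_comparison_test[OF _ summable_mult[OF b, of "M * A"]]) (auto simp: suminf_nonneg hs)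
  have col: "(\<Sum>j. d j l) = (if l = 0 then b $ n else 0)" for l
  proof -
    have "(\<Sum>j. d j l) = (\<Sum>j\<le>l. d j l)" by (rule suminf_finite) (auto simp: d_def)
    also have "\<dots> = b $ (n + l) * cnj (\<Sum>j\<le>l. b $ j * a $ (l - j))"
      by (simp add: d_def cnj_sum sum_distrib_left mult_ac)
    also have "(\<Sum>j\<le>l. b $ j * a $ (l - j)) = (b * a) $ l" by (simp add: fps_mult_nth atMost_atLeast0)
    also have "b * a = 1" using ab by (simp add: mult.commute)
    finally show ?thesis by simp
  qed
  have "b $ n = (\<Sum>l. \<Sum>j. d j l)" unfolding col by (subst suminf_finite[of "{0}"]) auto
  also have "\<dots> = (\<Sum>j. \<Sum>k. h j k)" using double_series(2)[OF row rows] by (simp add: rowsum)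
  finally have bn: "b $ n = (\<Sum>j. \<Sum>k. h j k)" .
  have hk: "(\<Sum>k. h j k) = (\<Sum>k. b $ (n + j + k) * cnj (a $ k)) * cnj (b $ j)" for j
  proof -
    have "summable (\<lambda>k. b $ (n + j + k) * cnj (a $ k))"
    proof (rule summable_comparison_test[OF _ summable_mult[OF a, of M]])
      show "\<exists>N. \<forall>k\<ge>N. norm (b $ (n + j + k) * cnj (a $ k)) \<le> M * cmod (a $ k)"
        using M by (auto simp: norm_mult intro!: mult_right_mono)
    qed
    then show ?thesis by (simp add: h_def suminf_mult2)
  qed
  show ?thesis using bn by (simp only: hk)
qed

text \<open>
  Subadditivity of \<open>t \<mapsto> t\<^sup>s\<close> for \<open>0 \<le> s \<le> 1\<close>: it distributes the weight \<open>n\<^sup>s\<close> over the two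
  factors of a product of power series.
\<close>

lemma powr_add_le:
  fixes s :: real
  assumes "0 \<le> s" "s \<le> 1"
  shows "real (j + k) powr s \<le> real j powr s + real k powr s"
proof (cases "j + k = 0")
  case False
  define t where "t = real (j + k)"
  have t: "t > 0" using False by (simp add: t_def del: of_nat_add)
  have part: "real i / t \<le> (real i / t) powr s" if "i \<le> j + k" for i
  proof (cases "i = 0")
    case False
    then have "(real i / t) powr 1 \<le> (real i / t) powr s"
      using that t assms by (intro powr_mono') (auto simp: t_def)
    then show ?thesis using False t by simp
  qed simp
  have "t powr s = t powr s * (real j / t + real k / t)" using t by (simp add: t_def add_divide_distrib[symmetric])
  also have "\<dots> \<le> t powr s * ((real j / t) powr s + (real k / t) powr s)"
    by (intro mult_left_mono add_mono part) auto
  also have "\<dots> = real j powr s + real k powr s"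
    using t by (simp add: distrib_left powr_divide)
  finally show ?thesis by (simp add: t_def)
qed simp

text \<open>
  The analytic core: if the nonnegative modes of \<open>exp (- \<i> (f + cnj f))\<close> are those of an
  \<open>H\<^bsup>1+s\<^esup>\<close> function, then \<open>f\<close> is in \<open>H\<^bsup>1+s\<^esup>\<close>, where \<open>f\<close> has the coefficients \<open>g\<close>. The
  reproducing identity moves coefficients of \<open>\<Pi> w\<close> only to lower modes, so the weight
  \<open>n\<^bsup>1+s\<^esup>\<close> can be put on \<open>\<Pi> w\<close> for free and \<open>B = exp (- \<i> f)\<close> inherits the regularity
  of \<open>\<Pi> w\<close>. Then \<open>f' = \<i> A B'\<close> recovers \<open>f\<close> from \<open>B\<close>.
\<close>

lemma regularity_from_projection:
  fixes g :: "complex fps" and s :: real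
  defines "b \<equiv> fps_exp (- \<i>) oo g" and "a \<equiv> fps_exp \<i> oo g"
  assumes g: "g $ 0 = 0" "summable (\<lambda>n. (real n * cmod (g $ n))\<^sup>2)"
    and s: "0 \<le> s" "s < 1/2"
    and p: "summable (\<lambda>n. (real n powr (1 + s) * cmod (\<Sum>k. b $ (n + k) * cnj (a $ k)))\<^sup>2)"
  shows "summable (\<lambda>n. (real n powr (1 + s) * cmod (g $ n))\<^sup>2)"
proof -
  have gl1: "summable (\<lambda>n. cmod (g $ n))" by (rule summable_of_summable_sq_weighted[OF g(2)])
  have al1: "summable (\<lambda>n. cmod (a $ n))" and bl1: "summable (\<lambda>n. cmod (b $ n))"
    unfolding a_def b_def by (rule fps_exp_compose_wiener(1)[OF gl1 g(1)])+
  have ab: "a * b = 1" using fps_exp_compose_inverse[OF g(1), of \<i>] by (simp add: a_def b_def)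
  have da: "fps_deriv a = fps_const \<i> * a * fps_deriv g"
    unfolding a_def by (rule fps_exp_compose_deriv[OF g(1)])
  have "fps_deriv b = fps_const (- \<i>) * b * fps_deriv g"
    unfolding b_def by (rule fps_exp_compose_deriv[OF g(1)])
  then have "fps_const \<i> * a * fps_deriv b = (fps_const \<i> * fps_const (- \<i>)) * (a * b) * fps_deriv g"
    by (simp only: mult_ac)
  then have dg: "fps_deriv g = fps_const \<i> * a * fps_deriv b"
    unfolding ab by simp

  define P where "P n = (\<Sum>k. b $ (n + k) * cnj (a $ k))" for n
  have bP: "b $ n = (\<Sum>j. P (n + j) * cnj (b $ j))" for n
    unfolding P_def by (rule toeplitz_reproduces[OF al1 bl1 ab])

  have bs: "summable (\<lambda>n. (real n powr (1 + s) * cmod (b $ n))\<^sup>2)"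
  proof (rule summable_sq_le)
    let ?x = "\<lambda>n. real n powr (1 + s) * cmod (P n)"
    have x: "summable (\<lambda>n. (?x n)\<^sup>2)" using p by (simp add: P_def)
    note cor = summable_sq_correlation[OF x _ bl1]
    show "summable (\<lambda>n. (\<Sum>j. cmod (b $ j) * ?x (n + j))\<^sup>2)" by (rule cor(2)) simp
    fix n
    have le: "cmod (real n powr (1 + s) * (P (n + j) * cnj (b $ j))) \<le> cmod (b $ j) * ?x (n + j)" for j
    proof -
      \<comment> \<open>only coefficients \<open>P (n + j)\<close>, of index at least \<open>n\<close>, contribute to \<open>b $ n\<close>\<close>
      have "real n powr (1 + s) \<le> real (n + j) powr (1 + s)" using s by (intro powr_mono2) auto
      then show ?thesis by (simp add: norm_mult mult_left_mono mult_right_mono mult_ac)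
    qed
    have sm: "summable (\<lambda>j. cmod (b $ j) * ?x (n + j))" by (rule cor(1)) simp
    have sm': "summable (\<lambda>j. cmod (real n powr (1 + s) * (P (n + j) * cnj (b $ j))))"
      by (rule summable_comparison_test[OF _ sm]) (use le in auto)
    show "\<bar>real n powr (1 + s) * cmod (b $ n)\<bar> \<le> (\<Sum>j. cmod (b $ j) * ?x (n + j))"
    proof (cases "n = 0")
      case True
      then show ?thesis using sm by (auto intro!: suminf_nonneg mult_nonneg_nonneg)
    next
      case False
      have "(\<Sum>j. complex_of_real (real n powr (1 + s)) * (P (n + j) * cnj (b $ j)))
          = complex_of_real (real n powr (1 + s)) * b $ n"
      proof -
        have "summable (\<lambda>j. P (n + j) * cnj (b $ j))"
          using summable_mult_D[OF summable_norm_cancel[OF sm']] False by simp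
        then show ?thesis unfolding bP[of n] by (rule suminf_mult)
      qed
      then have "\<bar>real n powr (1 + s) * cmod (b $ n)\<bar>
          = cmod (\<Sum>j. complex_of_real (real n powr (1 + s)) * (P (n + j) * cnj (b $ j)))"
        by (simp add: norm_mult)
      also have "\<dots> \<le> (\<Sum>j. cmod (real n powr (1 + s) * (P (n + j) * cnj (b $ j))))"
        by (rule summable_norm[OF sm'])
      also have "\<dots> \<le> (\<Sum>j. cmod (b $ j) * ?x (n + j))" by (rule suminf_le[OF le sm' sm])
      finally show ?thesis .
    qed
  qed

  \<comment> \<open>\<open>a' = \<i> a g'\<close> is a convolution of an \<open>\<ell>\<^sup>1\<close> and an \<open>\<ell>\<^sup>2\<close> sequence, so \<open>A\<close> is in \<open>H\<^sup>1\<close>\<close>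
  have as: "summable (\<lambda>n. (real n * cmod (a $ n))\<^sup>2)"
  proof -
    have "summable (\<lambda>n. (\<Sum>j\<le>n. cmod (a $ j) * (real (Suc (n - j)) * cmod (g $ Suc (n - j))))\<^sup>2)"
      using g(2)[THEN summable_Suc_iff[THEN iffD2]]
      by (intro summable_sq_convolution[OF _ _ al1]) simp_all
    moreover have "\<bar>real (Suc n) * cmod (a $ Suc n)\<bar>
        \<le> (\<Sum>j\<le>n. cmod (a $ j) * (real (Suc (n - j)) * cmod (g $ Suc (n - j))))" for n
    proof -
      have "\<bar>real (Suc n) * cmod (a $ Suc n)\<bar> = cmod (fps_deriv a $ n)"
        by (simp add: norm_mult del: of_nat_Suc)
      also have "\<dots> = cmod (\<Sum>j\<le>n. a $ j * (of_nat (Suc (n - j)) * g $ Suc (n - j)))"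
        by (simp add: da mult.assoc norm_mult fps_mult_nth[of a] atMost_atLeast0 del: of_nat_Suc)
      also have "\<dots> \<le> (\<Sum>j\<le>n. cmod (a $ j) * (real (Suc (n - j)) * cmod (g $ Suc (n - j))))"
        by (rule order_trans[OF norm_sum]) (simp add: norm_mult del: of_nat_Suc)
      finally show ?thesis .
    qed
    ultimately have "summable (\<lambda>n. (real (Suc n) * cmod (a $ Suc n))\<^sup>2)" by (rule summable_sq_le)
    then show ?thesis by (subst (asm) summable_Suc_iff)
  qed

  have asl1: "summable (\<lambda>n. real n powr s * cmod (a $ n))"
    using summable_powr_mult[OF s(2) as] by simp

  \<comment> \<open>In \<open>g' = \<i> a b'\<close> the weight \<open>n\<^sup>s\<close> falls on \<open>b'\<close>, which is in weighted \<open>\<ell>\<^sup>2\<close> by \<open>bs\<close>,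
     or on \<open>a\<close>, which is in weighted \<open>\<ell>\<^sup>1\<close> by \<open>asl1\<close>.\<close>
  define x where "x n = real (Suc n) * cmod (b $ Suc n)" for n
  have weight: "real (Suc n) powr (1 + s) = real (Suc n) powr s * real (Suc n)" for n
    by (simp add: powr_add mult.commute)
  have x1: "summable (\<lambda>n. (real (Suc n) powr s * x n)\<^sup>2)"
    using bs unfolding summable_Suc_iff[of "\<lambda>n. (real n powr (1 + s) * cmod (b $ n))\<^sup>2", symmetric]
    by (simp only: x_def weight mult.assoc)
  have x0: "summable (\<lambda>n. (x n)\<^sup>2)"
  proof (rule summable_sq_le[OF x1])
    fix n
    have "1 \<le> real (Suc n) powr s" using s by (intro ge_one_powr_ge_zero) auto
    then show "\<bar>x n\<bar> \<le> real (Suc n) powr s * x n"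
      by (auto simp: x_def simp del: of_nat_Suc intro!: mult_le_cancel_right1[THEN iffD2])
  qed
  have "summable (\<lambda>n. ((\<Sum>j\<le>n. cmod (a $ j) * (real (Suc (n - j)) powr s * x (n - j)))
      + (\<Sum>j\<le>n. real j powr s * cmod (a $ j) * x (n - j)))\<^sup>2)"
    by (intro summable_sq_add summable_sq_convolution x0 x1 al1 asl1) auto
  moreover have "\<bar>real (Suc n) powr (1 + s) * cmod (g $ Suc n)\<bar>
      \<le> (\<Sum>j\<le>n. cmod (a $ j) * (real (Suc (n - j)) powr s * x (n - j)))
      + (\<Sum>j\<le>n. real j powr s * cmod (a $ j) * x (n - j))" for n
  proof -
    have "\<bar>real (Suc n) powr (1 + s) * cmod (g $ Suc n)\<bar> = real (Suc n) powr s * cmod (fps_deriv g $ n)"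
      by (simp add: weight norm_mult del: of_nat_Suc)
    also have "\<dots> = real (Suc n) powr s * cmod (\<Sum>j\<le>n. a $ j * (of_nat (Suc (n - j)) * b $ Suc (n - j)))"
      by (simp add: dg mult.assoc norm_mult fps_mult_nth[of a] atMost_atLeast0 del: of_nat_Suc)
    also have "\<dots> \<le> real (Suc n) powr s * (\<Sum>j\<le>n. cmod (a $ j) * x (n - j))"
      by (intro mult_left_mono order_trans[OF norm_sum]) (simp_all add: x_def norm_mult del: of_nat_Suc)
    also have "\<dots> \<le> (\<Sum>j\<le>n. cmod (a $ j) * (real (Suc (n - j)) powr s * x (n - j))
        + real j powr s * cmod (a $ j) * x (n - j))"
      unfolding sum_distrib_left
    proof (rule sum_mono)
      fix j assume "j \<in> {..n}"
      then have "real (Suc n) powr s \<le> real (Suc (n - j)) powr s + real j powr s"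
        using powr_add_le[of s "Suc (n - j)" j] s by simp
      then have "real (Suc n) powr s * (cmod (a $ j) * x (n - j))
          \<le> (real (Suc (n - j)) powr s + real j powr s) * (cmod (a $ j) * x (n - j))"
        by (intro mult_right_mono) (auto simp: x_def)
      then show "real (Suc n) powr s * (cmod (a $ j) * x (n - j))
          \<le> cmod (a $ j) * (real (Suc (n - j)) powr s * x (n - j)) + real j powr s * cmod (a $ j) * x (n - j)"
        by (simp add: algebra_simps)
    qed
    finally show ?thesis by (simp add: sum.distrib)
  qed
  ultimately have "summable (\<lambda>n. (real (Suc n) powr (1 + s) * cmod (g $ Suc n))\<^sup>2)"
    by (rule summable_sq_le)
  then show ?thesis by (subst (asm) summable_Suc_iff)
qed

section \<open>Fourier series on the circle\<close>

lemma fourier_mode_power: "fourier_mode (int n) x = fourier_mode 1 x ^ n"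
  by (simp add: fourier_mode_def exp_of_nat_mult[symmetric] mult_ac)

lemma fourier_mode_add: "fourier_mode (m + n) x = fourier_mode m x * fourier_mode n x"
  by (simp add: fourier_mode_def exp_add[symmetric] algebra_simps)

lemma cnj_fourier_mode: "cnj (fourier_mode n x) = fourier_mode (- n) x"
  by (simp add: fourier_mode_def exp_cnj)

lemma norm_fourier_mode [simp]: "cmod (fourier_mode n x) = 1"
  by (simp add: fourier_mode_def)

lemma fourier_mode_measurable [measurable]: "fourier_mode n \<in> borel_measurable borel"
  unfolding fourier_mode_def[abs_def] by (intro borel_measurable_continuous_onI continuous_intros)

lemma fourier_mode_vector_derivative:
  "(fourier_mode n has_vector_derivative \<i> * of_int n * fourier_mode n x) (at x within S)"
proof -
  have "((\<lambda>z. exp (\<i> * of_int n * z)) has_field_derivative \<i> * of_int n * exp (\<i> * of_int n * of_real x))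
      (at (of_real x))"
    by (auto intro!: derivative_eq_intros)
  from has_vector_derivative_real_field[OF this]
  show ?thesis unfolding fourier_mode_def[abs_def]
    by (rule has_vector_derivative_at_within)
qed

lemma bounded_set_integrable_circle:
  fixes f :: "real \<Rightarrow> complex"
  assumes "f \<in> borel_measurable borel" "\<And>x. cmod (f x) \<le> K"
  shows "set_integrable lebesgue {0..2 * pi} f"
  unfolding set_integrable_def
proof (rule integrableI_bounded_set_indicator)
  show "f \<in> borel_measurable lebesgue" using assms(1) by (simp add: measurable_completion)
qed (use assms(2) in auto)

lemma integral_fourier_mode:
  "(LINT x:{0..2 * pi}|lebesgue. fourier_mode n x) = (if n = 0 then 2 * of_real pi else 0)"
proof -
  have "(LINT x:{0..2 * pi}|lebesgue. fourier_mode n x) = integral {0..2 * pi} (fourier_mode n)"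
    by (rule set_lebesgue_integral_eq_integral(2)[OF bounded_set_integrable_circle[where K = 1]]) auto
  also have "\<dots> = (if n = 0 then 2 * of_real pi else 0)"
  proof (cases "n = 0")
    case True
    then have "fourier_mode n = (\<lambda>_. 1)" by (simp add: fourier_mode_def fun_eq_iff)
    then show ?thesis using True by (simp add: scaleR_conv_of_real)
  next
    case False
    let ?F = "\<lambda>x. fourier_mode n x / (\<i> * of_int n)"
    have "(fourier_mode n has_integral ?F (2 * pi) - ?F 0) {0..2 * pi}"
    proof (rule fundamental_theorem_of_calculus)
      fix x
      have "(?F has_vector_derivative (\<i> * of_int n * fourier_mode n x) / (\<i> * of_int n)) (at x within {0..2 * pi})"
        by (rule has_vector_derivative_divide[OF fourier_mode_vector_derivative])
      then show "(?F has_vector_derivative fourier_mode n x) (at x within {0..2 * pi})"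
        using False by simp
    qed simp
    moreover have "fourier_mode n (2 * pi) = fourier_mode n 0"
    proof -
      have "fourier_mode n (2 * pi) = exp (of_int n * (2 * of_real pi * \<i>))"
        by (simp add: fourier_mode_def mult_ac)
      also have "\<dots> = 1" using exp_integer_2pi[of "of_int n"] by (simp add: mult_ac)
      finally show ?thesis by (simp add: fourier_mode_def)
    qed
    ultimately show ?thesis using False by (simp add: integral_unique)
  qed
  finally show ?thesis .
qed

lemma circle_integral_series:
  fixes c :: "nat \<Rightarrow> complex" and \<phi> :: "nat \<Rightarrow> real \<Rightarrow> complex"
  assumes c: "summable (\<lambda>n. cmod (c n))"
    and meas: "\<And>n. \<phi> n \<in> borel_measurable borel" and K: "\<And>n x. cmod (\<phi> n x) \<le> K"
  shows "(LINT x:{0..2 * pi}|lebesgue. (\<Sum>n. c n * \<phi> n x))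
       = (\<Sum>n. c n * (LINT x:{0..2 * pi}|lebesgue. \<phi> n x))"
proof -
  define f where "f n x = indicator {0..2 * pi} x *\<^sub>R (c n * \<phi> n x)" for n and x :: real
  have K0: "0 \<le> K" using K[of 0 0] norm_ge_zero order_trans by blast
  have int: "integrable lebesgue (f n)" for n
  proof -
    have "set_integrable lebesgue {0..2 * pi} (\<lambda>x. c n * \<phi> n x)"
      by (rule bounded_set_integrable_circle[where K = "cmod (c n) * K"])
         (use meas[of n] K in \<open>auto simp: norm_mult mult_left_mono\<close>)
    then show ?thesis by (simp add: set_integrable_def f_def[abs_def])
  qed
  have ptw: "summable (\<lambda>n. norm (f n x))" for x
    by (rule summable_comparison_test[OF _ summable_mult2[OF c, of K]])
       (use K K0 in \<open>auto simp: f_def norm_mult indicator_def mult_left_mono\<close>)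
  have "(LINT x|lebesgue. norm (f n x)) \<le> cmod (c n) * K * (2 * pi)" for n
  proof -
    have "(LINT x|lebesgue. norm (f n x)) \<le> (LINT x|lebesgue. indicator {0..2 * pi} x *\<^sub>R (cmod (c n) * K))"
    proof (rule integral_mono)
      show "integrable lebesgue (\<lambda>x. indicator {0..2 * pi} x *\<^sub>R (cmod (c n) * K))"
        by (rule integrableI_bounded_set_indicator[where B = "cmod (c n) * K"]) (use K0 in \<open>auto simp: abs_mult\<close>)
      show "norm (f n x) \<le> indicator {0..2 * pi} x *\<^sub>R (cmod (c n) * K)" for x
        using K by (auto simp: f_def norm_mult indicator_def mult_left_mono)
    qed (use int in auto)
    then show ?thesis by (simp add: mult_ac)
  qed
  then have sums: "summable (\<lambda>n. LINT x|lebesgue. norm (f n x))"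
    by (intro summable_comparison_test[OF _ summable_mult2[OF c, of "K * (2 * pi)"]])
       (auto simp: integral_nonneg_AE mult_ac)
  have "(LINT x:{0..2 * pi}|lebesgue. (\<Sum>n. c n * \<phi> n x)) = (LINT x|lebesgue. (\<Sum>n. f n x))"
    unfolding set_lebesgue_integral_def f_def
    by (intro Bochner_Integration.integral_cong) (auto simp: indicator_def)
  also have "\<dots> = (\<Sum>n. LINT x|lebesgue. f n x)"
    by (rule integral_suminf) (use int ptw sums in auto)
  finally have "(LINT x:{0..2 * pi}|lebesgue. (\<Sum>n. c n * \<phi> n x)) = (\<Sum>n. LINT x|lebesgue. f n x)" .
  moreover have "(LINT x|lebesgue. f n x) = c n * (LINT x:{0..2 * pi}|lebesgue. \<phi> n x)" for n
    unfolding f_def set_integral_mult_right[symmetric] by (simp only: set_lebesgue_integral_def)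
  ultimately show ?thesis by (simp only:)
qed

text \<open>
  Integrate term by term twice: expanding the antianalytic factor first reduces the claim
  to the Fourier coefficients of the analytic one.
\<close>

lemma fourier_coeff_wiener_product:
  fixes a b :: "nat \<Rightarrow> complex"
  assumes a: "summable (\<lambda>n. cmod (a n))" and b: "summable (\<lambda>n. cmod (b n))"
  shows "fourier_coeff (\<lambda>x. (\<Sum>n. b n * fourier_mode (int n) x) * cnj (\<Sum>n. a n * fourier_mode (int n) x)) (int m)
       = (\<Sum>k. b (m + k) * cnj (a k))"
proof -
  define B where "B x = (\<Sum>n. b n * fourier_mode (int n) x)" for x
  have Bm: "B \<in> borel_measurable borel" unfolding B_def[abs_def] by measurable
  have sm: "summable (\<lambda>n. cmod (b n * fourier_mode (int n) x))" for x
    using b by (simp add: norm_mult)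
  have Bb: "cmod (B x) \<le> (\<Sum>n. cmod (b n))" for x
    unfolding B_def using summable_norm[OF sm[of x]] by (simp add: norm_mult)
  have coeffB: "(LINT x:{0..2 * pi}|lebesgue. B x * fourier_mode (- int l) x) = 2 * of_real pi * b l" for l
  proof -
    have "B x * fourier_mode (- int l) x = (\<Sum>n. b n * fourier_mode (int n - int l) x)" for x
      unfolding B_def using suminf_mult2[OF summable_norm_cancel[OF sm]] fourier_mode_add[of "int _" "- int l" x]
      by (simp add: mult.assoc)
    then have "(LINT x:{0..2 * pi}|lebesgue. B x * fourier_mode (- int l) x)
        = (LINT x:{0..2 * pi}|lebesgue. (\<Sum>n. b n * fourier_mode (int n - int l) x))" by simp
    also have "\<dots> = (\<Sum>n. b n * (LINT x:{0..2 * pi}|lebesgue. fourier_mode (int n - int l) x))"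
      by (rule circle_integral_series[OF b, where K = 1]) auto
    also have "\<dots> = 2 * of_real pi * b l"
      unfolding integral_fourier_mode by (subst suminf_finite[of "{l}"]) auto
    finally show ?thesis .
  qed
  have "B x * cnj (\<Sum>n. a n * fourier_mode (int n) x) * fourier_mode (- int m) x
      = (\<Sum>k. cnj (a k) * (B x * fourier_mode (- int (m + k)) x))" for x
  proof -
    have s: "summable (\<lambda>k. a k * fourier_mode (int k) x)"
      by (rule summable_norm_cancel) (use a in \<open>simp add: norm_mult\<close>)
    have "(\<lambda>k. cnj (a k * fourier_mode (int k) x)) sums cnj (\<Sum>n. a n * fourier_mode (int n) x)"
      using summable_sums[OF s] by (simp only: sums_cnj)
    then have S: "(\<lambda>k. B x * fourier_mode (- int m) x * cnj (a k * fourier_mode (int k) x))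
        sums (B x * fourier_mode (- int m) x * cnj (\<Sum>n. a n * fourier_mode (int n) x))"
      by (rule sums_mult)
    have term_k: "B x * fourier_mode (- int m) x * cnj (a k * fourier_mode (int k) x)
        = cnj (a k) * (B x * fourier_mode (- int (m + k)) x)" for k
      using fourier_mode_add[of "- int m" "- int k" x] by (simp add: cnj_fourier_mode mult_ac)
    show ?thesis using sums_unique[OF S] unfolding term_k by (simp only: mult_ac)
  qed
  then have "(LINT x:{0..2 * pi}|lebesgue. B x * cnj (\<Sum>n. a n * fourier_mode (int n) x) * fourier_mode (- int m) x)
      = (LINT x:{0..2 * pi}|lebesgue. (\<Sum>k. cnj (a k) * (B x * fourier_mode (- int (m + k)) x)))" by simp
  also have "\<dots> = (\<Sum>k. cnj (a k) * (LINT x:{0..2 * pi}|lebesgue. B x * fourier_mode (- int (m + k)) x))"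
    by (rule circle_integral_series[where K = "\<Sum>n. cmod (b n)"]) (use a Bm Bb in \<open>auto simp: norm_mult\<close>)
  also have "\<dots> = (\<Sum>k. 2 * of_real pi * (b (m + k) * cnj (a k)))"
    unfolding coeffB by (simp only: mult_ac)
  also have "\<dots> = 2 * of_real pi * (\<Sum>k. b (m + k) * cnj (a k))"
  proof (rule suminf_mult, rule summable_norm_cancel)
    have "cmod (b l) \<le> (\<Sum>n. cmod (b n))" for l using sum_le_suminf[OF b, of "{l}"] by simp
    then show "summable (\<lambda>k. cmod (b (m + k) * cnj (a k)))"
      by (intro summable_comparison_test[OF _ summable_mult[OF a, of "\<Sum>n. cmod (b n)"]])
         (auto simp: norm_mult intro!: mult_right_mono)
  qed
  finally show ?thesis by (simp add: fourier_coeff_def B_def)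
qed

text \<open>
  For a test function \<open>e\<^bsup>-inx\<^esup>\<close> the series that defines the projection has a single nonzero
  term, by orthogonality.
\<close>

lemma distr_fourier_coeff_deriv_proj:
  "distr_fourier_coeff (distr_deriv (distr_proj T)) (int n) = \<i> * of_nat n * distr_fourier_coeff T (int n)"
proof -
  have deriv: "vector_derivative (fourier_mode (- int n)) (at x) = - \<i> * of_nat n * fourier_mode (- int n) x" for x
    using vector_derivative_at[OF fourier_mode_vector_derivative[of "- int n" x UNIV]] by simp
  have pair: "distr_of (fourier_mode m) (\<lambda>x. - \<i> * of_nat n * fourier_mode (- int n) x)
      = (if m = int n then - \<i> * of_nat n * (2 * of_real pi) else 0)" for m
  proof -
    have "fourier_mode m x * (- \<i> * of_nat n * fourier_mode (- int n) x)
        = (- \<i> * of_nat n) * fourier_mode (m - int n) x" for x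
      using fourier_mode_add[of m "- int n" x] by simp
    then show ?thesis unfolding distr_of_def
      by (simp only: set_integral_mult_right) (simp add: integral_fourier_mode)
  qed
  have "distr_proj T (\<lambda>x. - \<i> * of_nat n * fourier_mode (- int n) x)
      = (\<Sum>\<^sub>\<infinity>m\<in>{int n}. distr_fourier_coeff T m * (if m = int n then - \<i> * of_nat n * (2 * of_real pi) else 0))"
    unfolding distr_proj_def pair by (rule infsum_cong_neutral) auto
  then have "distr_proj T (\<lambda>x. - \<i> * of_nat n * fourier_mode (- int n) x)
      = distr_fourier_coeff T (int n) * (- \<i> * of_nat n * (2 * of_real pi))" by simp
  then show ?thesis
    unfolding distr_fourier_coeff_def[of "distr_deriv _"] distr_deriv_def deriv by simp
qed

section \<open>The gauge transform and admissible data\<close>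

lemma fourier_coeff_real_minus:
  "fourier_coeff (\<lambda>x. complex_of_real (v x)) (- n) = cnj (fourier_coeff (\<lambda>x. complex_of_real (v x)) n)"
proof -
  have "cnj (LINT x:{0..2 * pi}|lebesgue. complex_of_real (v x) * fourier_mode (- n) x)
      = (LINT x:{0..2 * pi}|lebesgue. cnj (complex_of_real (v x) * fourier_mode (- n) x))"
    unfolding set_lebesgue_integral_def by (simp only: Bochner_Integration.integral_cnj[symmetric] complex_cnj_scaleR)
  then show ?thesis by (simp add: fourier_coeff_def cnj_fourier_mode)
qed

lemma summable_on_int_even:
  fixes F :: "int \<Rightarrow> real"
  assumes "\<And>n. F (- n) = F n" "\<And>n. 0 \<le> F n" "summable (\<lambda>n. F (int n))"
  shows "F summable_on UNIV"
proof -
  have "UNIV = range int \<union> range (\<lambda>n. - int (Suc n))"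
  proof (intro equalityI subsetI)
    fix x :: int
    show "x \<in> range int \<union> range (\<lambda>n. - int (Suc n))" by (cases x) auto
  qed simp
  moreover have "F summable_on range int"
    using assms by (subst summable_on_reindex) (auto simp: o_def summable_on_UNIV_nonneg_real_iff)
  moreover have "F summable_on range (\<lambda>n. - int (Suc n))"
  proof (subst summable_on_reindex)
    show "inj (\<lambda>n. - int (Suc n))" by (auto simp: inj_on_def)
    have "summable (\<lambda>n. F (int (Suc n)))" using assms(3) by (subst summable_Suc_iff)
    then show "(F \<circ> (\<lambda>n. - int (Suc n))) summable_on UNIV"
      unfolding o_def assms(1) by (subst summable_on_UNIV_nonneg_real_iff) (use assms in auto)
  qed
  moreover have "range int \<inter> range (\<lambda>n. - int (Suc n)) = {}" by auto
  ultimately show ?thesis by (metis summable_on_Un_disjoint)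
qed

text \<open>
  The terms of index \<open>n\<close> and \<open>-n\<close> are conjugate because \<open>v\<close> is real.
\<close>

lemma antideriv_eq_two_Re:
  fixes v :: "real \<Rightarrow> real"
  defines "c \<equiv> fourier_coeff (\<lambda>x. complex_of_real (v x))"
  assumes sm: "summable (\<lambda>n. cmod (c (int n) / (\<i> * of_nat n)))"
  defines "f \<equiv> \<lambda>x. \<Sum>n. c (int n) / (\<i> * of_nat n) * fourier_mode (int n) x"
  shows "antideriv (\<lambda>x. complex_of_real (v x)) x = f x + cnj (f x)"
proof -
  define h where "h n = 1 / (\<i> * of_int n) * c n * fourier_mode n x" for n :: int
  define q where "q n = c (int n) / (\<i> * of_nat n) * fourier_mode (int n) x" for n
  have hq: "h (int n) = q n" for n by (simp add: h_def q_def)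
  have hq': "h (- int n) = cnj (q n)" for n
    using fourier_coeff_real_minus[of v "int n"]
    by (simp add: h_def q_def cnj_fourier_mode c_def)
  have q: "summable (\<lambda>n. cmod (q n))" using sm by (simp only: q_def norm_mult norm_fourier_mode mult_1_right)
  have infs: "infsum r {1..} = suminf r" "r summable_on {1..}"
    if r: "summable (\<lambda>n. cmod (r n))" and r0: "r 0 = 0" for r :: "nat \<Rightarrow> complex"
  proof -
    have "infsum r {1..} = infsum r UNIV" by (rule infsum_cong_neutral) (use r0 in \<open>auto simp: not_le\<close>)
    then show "infsum r {1..} = suminf r"
      using infsumI[OF norm_summable_imp_has_sum[OF r]] summable_norm_cancel[OF r] by (simp add: summable_sums)
    show "r summable_on {1..}"
      by (rule summable_on_subset_banach[OF norm_summable_imp_summable_on[OF r]]) simp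
  qed
  have q0: "q 0 = 0" by (simp add: q_def)
  have cq: "summable (\<lambda>n. cmod (cnj (q n)))" using q by simp
  have pos: "infsum h (int ` {1..}) = suminf q" "h summable_on int ` {1..}"
    using infs[OF q q0] by (simp_all add: infsum_reindex summable_on_reindex o_def hq)
  have inj: "inj_on (\<lambda>n. - int n) {1..}" by (auto simp: inj_on_def)
  have neg: "infsum h ((\<lambda>n. - int n) ` {1..}) = (\<Sum>n. cnj (q n))" "h summable_on (\<lambda>n. - int n) ` {1..}"
    unfolding infsum_reindex[OF inj] summable_on_reindex[OF inj] o_def hq'
    using infs[OF cq] q0 by simp_all
  have un: "UNIV - {0 :: int} = int ` {1..} \<union> (\<lambda>n. - int n) ` {1..}"
  proof (intro equalityI subsetI)
    fix m :: int assume "m \<in> UNIV - {0}"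
    then have "m = int (nat m) \<and> nat m \<ge> 1 \<or> m = - int (nat (- m)) \<and> nat (- m) \<ge> 1" by auto
    then show "m \<in> int ` {1..} \<union> (\<lambda>n. - int n) ` {1..}" by blast
  qed auto
  have "antideriv (\<lambda>x. complex_of_real (v x)) x = infsum h (UNIV - {0})"
    by (simp add: antideriv_def h_def[abs_def] c_def)
  also have "\<dots> = suminf q + (\<Sum>n. cnj (q n))"
  proof -
    have "int ` {1..} \<inter> (\<lambda>n. - int n) ` {1..} = {}" by auto
    then show ?thesis unfolding un by (simp only: infsum_Un_disjoint[OF pos(2) neg(2)] pos(1) neg(1))
  qed
  also have "(\<Sum>n. cnj (q n)) = cnj (suminf q)"
  proof -
    have "(\<lambda>n. cnj (q n)) sums cnj (suminf q)"
      using summable_norm_cancel[OF q] by (simp only: sums_cnj summable_sums)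
    then show ?thesis by (simp add: sums_iff)
  qed
  also have "suminf q = f x" by (simp only: f_def q_def[abs_def])
  finally show ?thesis .
qed

text \<open>
  Writing the antiderivative as \<open>f + cnj f\<close>, the gauge factor splits as
  \<open>exp (- \<i> f) \<cdot> cnj (exp (\<i> f))\<close>, a product of an analytic and an antianalytic function,
  both with absolutely convergent Fourier series.
\<close>

lemma gauge_transform_coeff:
  fixes u :: "real \<Rightarrow> real"
  defines "g \<equiv> Abs_fps (\<lambda>n. fourier_coeff (\<lambda>x. complex_of_real (u x)) (int n) / (\<i> * of_nat n))"
  assumes g: "summable (\<lambda>n. cmod (g $ n))"
  shows "distr_fourier_coeff (gauge_transform u) (int n)
       = \<i> * of_nat n * (\<Sum>k. (fps_exp (- \<i>) oo g) $ (n + k) * cnj ((fps_exp \<i> oo g) $ k))"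
proof -
  let ?b = "fps_exp (- \<i>) oo g" and ?a = "fps_exp \<i> oo g"
  have g0: "g $ 0 = 0" by (simp add: g_def)
  define f where "f x = (\<Sum>n. g $ n * fourier_mode (int n) x)" for x
  have F: "antideriv (\<lambda>y. complex_of_real (u y)) x = f x + cnj (f x)" for x
    using antideriv_eq_two_Re[of u x] g by (simp add: f_def g_def)
  have ser: "(\<Sum>n. (fps_exp c oo g) $ n * fourier_mode (int n) x) = exp (c * f x)" for c x
    using fps_exp_compose_wiener(2)[OF g g0, of "fourier_mode 1 x" c]
    by (simp add: f_def fourier_mode_power)
  have "exp (- \<i> * antideriv (\<lambda>y. complex_of_real (u y)) x)
      = (\<Sum>n. ?b $ n * fourier_mode (int n) x) * cnj (\<Sum>n. ?a $ n * fourier_mode (int n) x)" for x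
    unfolding ser F by (simp add: exp_cnj exp_add[symmetric] algebra_simps)
  then have "gauge_transform u = distr_deriv (distr_proj (distr_of
      (\<lambda>x. (\<Sum>n. ?b $ n * fourier_mode (int n) x) * cnj (\<Sum>n. ?a $ n * fourier_mode (int n) x))))"
    by (simp add: gauge_transform_def)
  then show ?thesis
    by (simp add: distr_fourier_coeff_deriv_proj distr_fourier_coeff_distr_of
        fourier_coeff_wiener_product[OF fps_exp_compose_wiener(1)[OF g g0] fps_exp_compose_wiener(1)[OF g g0]])
qed

text \<open>
  For the sequence \<open>p\<close> of coefficients of the gauge factor, the point profiles contribute
  \<open>O(n\<^bsup>-2\<^esup>)\<close>, hence \<open>O(n\<^bsup>s-1\<^esup>)\<close> after weighting; this is where \<open>s < 1/2\<close> is forced.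
  The remainder contributes \<open>n\<^sup>s \<bar>\<rho>\<^sub>n\<bar>\<close>, and \<open>n\<^sup>s \<le> n\<^bsup>1/2+\<epsilon>\<^esup>\<close>.
\<close>

lemma Talbot_profile_weighted_l2:
  fixes p \<rho> :: "nat \<Rightarrow> complex" and a :: "nat \<Rightarrow> real" and c :: "nat \<Rightarrow> complex"
  assumes s: "0 \<le> s" "s < 1/2" and eps: "\<epsilon> > 0" and \<rho>: "\<rho> \<in> weighted_l2 (1/2 + \<epsilon>)"
    and p: "\<And>n. n \<ge> 1 \<Longrightarrow> \<i> * of_nat n * p n
      = (\<Sum>j=1..J. c j * exp (- \<i> * of_nat n * of_real (a j)) / of_nat n) + \<rho> n"
  shows "summable (\<lambda>n. (real n powr (1 + s) * cmod (p n))\<^sup>2)"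
proof (rule summable_sq_le)
  define C where "C = (\<Sum>j=1..J. cmod (c j))"
  have "(\<lambda>n. (real n powr (1/2 + \<epsilon>) * cmod (\<rho> n))\<^sup>2) summable_on UNIV"
  proof -
    have "real n powr (2 * (1/2 + \<epsilon>)) * (cmod (\<rho> n))\<^sup>2 = (real n powr (1/2 + \<epsilon>) * cmod (\<rho> n))\<^sup>2" for n
      by (simp only: power_mult_distrib power2_eq_square[of "_ powr _"] powr_add[symmetric] mult_2)
    then have "(\<lambda>n. (real n powr (1/2 + \<epsilon>) * cmod (\<rho> n))\<^sup>2) summable_on {1..}"
      using \<rho> by (simp only: weighted_l2_def mem_Collect_eq)
    then show ?thesis
      by (rule summable_on_cong_neutral[THEN iffD1, rotated -1]) (auto simp: not_le)
  qed
  then have \<rho>s: "summable (\<lambda>n. (real n powr (1/2 + \<epsilon>) * cmod (\<rho> n))\<^sup>2)"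
    by (subst (asm) summable_on_UNIV_nonneg_real_iff) auto
  have "summable (\<lambda>n. (C * real n powr (s - 1))\<^sup>2)"
    using summable_mult[OF summable_sq_powr[OF s(2)], of "C\<^sup>2"] by (simp add: power_mult_distrib)
  then show "summable (\<lambda>n. (C * real n powr (s - 1) + real n powr (1/2 + \<epsilon>) * cmod (\<rho> n))\<^sup>2)"
    by (rule summable_sq_add[OF _ \<rho>s])
  fix n
  show "\<bar>real n powr (1 + s) * cmod (p n)\<bar> \<le> C * real n powr (s - 1) + real n powr (1/2 + \<epsilon>) * cmod (\<rho> n)"
  proof (cases "n = 0")
    case False
    then have n: "n \<ge> 1" by simp
    have ex: "cmod (exp (- \<i> * of_nat n * of_real (a j))) = 1" for j
      using norm_exp_i_times[of "- (real n * a j)"] by (simp add: mult.assoc)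
    have "real n * cmod (p n) = cmod (\<i> * of_nat n * p n)" by (simp add: norm_mult)
    also have "\<dots> \<le> cmod (\<Sum>j=1..J. c j * exp (- \<i> * of_nat n * of_real (a j)) / of_nat n) + cmod (\<rho> n)"
      unfolding p[OF n] by (rule norm_triangle_ineq)
    also have "cmod (\<Sum>j=1..J. c j * exp (- \<i> * of_nat n * of_real (a j)) / of_nat n) \<le> C / real n"
      unfolding C_def sum_divide_distrib
      by (rule order_trans[OF norm_sum]) (simp only: norm_divide norm_mult ex norm_of_nat mult_1_right order_refl)
    finally have le: "real n * cmod (p n) \<le> C / real n + cmod (\<rho> n)" by simp
    have "real n powr (1 + s) * cmod (p n) = real n powr s * (real n * cmod (p n))"
      using False by (simp add: powr_add)
    also have "\<dots> \<le> real n powr s * (C / real n + cmod (\<rho> n))"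
      using le by (rule mult_left_mono) simp
    also have "\<dots> = C * real n powr (s - 1) + real n powr s * cmod (\<rho> n)"
      using False by (simp add: powr_diff distrib_left)
    also have "real n powr s * cmod (\<rho> n) \<le> real n powr (1/2 + \<epsilon>) * cmod (\<rho> n)"
      using s eps n by (intro mult_right_mono powr_mono) auto
    finally show ?thesis by simp
  qed simp
qed

lemma Sobolev_r0I:
  assumes u: "u \<in> L2_r0" and s: "0 \<le> s"
    and c: "summable (\<lambda>n. (real n powr s * cmod (fourier_coeff (\<lambda>x. complex_of_real (u x)) (int n)))\<^sup>2)"
  shows "u \<in> Sobolev_r0 s"
proof -
  define c where "c = fourier_coeff (\<lambda>x. complex_of_real (u x))"
  have c0: "c 0 = 0" using u by (simp add: Sobolev_r0_def c_def)
  have "(\<lambda>n. (1 + (real_of_int n)\<^sup>2) powr s * (cmod (c n))\<^sup>2) summable_on UNIV"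
  proof (rule summable_on_int_even)
    show "summable (\<lambda>n. (1 + (real_of_int (int n))\<^sup>2) powr s * (cmod (c (int n)))\<^sup>2)"
    proof (rule summable_comparison_test)
      show "summable (\<lambda>n. 2 powr s * (real n powr s * cmod (c (int n)))\<^sup>2)"
        using assms(3) unfolding c_def by (rule summable_mult)
      have "(1 + (real n)\<^sup>2) powr s * (cmod (c (int n)))\<^sup>2 \<le> 2 powr s * (real n powr s * cmod (c (int n)))\<^sup>2" for n
      proof (cases "n = 0")
        case False
        then have "1 \<le> (real n)\<^sup>2" by (simp add: one_le_power)
        then have "(1 + (real n)\<^sup>2) powr s \<le> (2 * (real n)\<^sup>2) powr s" using s by (intro powr_mono2) auto
        also have "\<dots> = 2 powr s * (real n powr s)\<^sup>2"
          by (simp add: powr_mult power2_eq_square)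
        finally show ?thesis by (simp add: power_mult_distrib mult_right_mono flip: mult.assoc)
      qed (simp add: c0)
      then show "\<exists>N. \<forall>n\<ge>N. norm ((1 + (real_of_int (int n))\<^sup>2) powr s * (cmod (c (int n)))\<^sup>2)
          \<le> 2 powr s * (real n powr s * cmod (c (int n)))\<^sup>2" by simp
    qed
  qed (simp_all add: c_def fourier_coeff_real_minus)
  then show ?thesis using u by (simp add: Sobolev_r0_def Sobolev_def c_def)
qed

text \<open>
  Since \<open>g\<close> is the antiderivative of the positive part of \<open>u\<close>, the \<open>H\<^bsup>1+s\<^esup>\<close> weight on \<open>g\<close>
  is the \<open>H\<^sup>s\<close> weight on \<open>u\<close> (fact \<open>ng\<close>).
\<close>

lemma Talbot_admissible_imp_Sobolev:
  assumes T: "Talbot_admissible u" and s: "0 \<le> s" "s < 1/2"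
  shows "u \<in> Sobolev_r0 s"
proof -
  define c where "c = fourier_coeff (\<lambda>x. complex_of_real (u x))"
  define g where "g = Abs_fps (\<lambda>n. c (int n) / (\<i> * of_nat n))"
  have u: "u \<in> L2_r0" using T by (simp add: Talbot_admissible_def)
  have "(\<lambda>n::int. (cmod (c n))\<^sup>2) summable_on UNIV"
  proof -
    have "1 + (real_of_int n)\<^sup>2 \<noteq> 0" for n using zero_le_power2[of "real_of_int n"] by linarith
    then show ?thesis using u by (simp add: Sobolev_r0_def Sobolev_def c_def)
  qed
  then have "(\<lambda>n::int. (cmod (c n))\<^sup>2) summable_on range int" by (rule summable_on_subset_banach) simp
  then have cl2: "summable (\<lambda>n. (cmod (c (int n)))\<^sup>2)"
    by (simp add: summable_on_reindex o_def summable_on_UNIV_nonneg_real_iff)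
  have ng: "real n powr (1 + r) * cmod (g $ n) = real n powr r * cmod (c (int n))" for n r
    by (cases "n = 0") (simp_all add: g_def norm_divide norm_mult powr_add)
  have g2: "summable (\<lambda>n. (real n * cmod (g $ n))\<^sup>2)"
    by (rule summable_sq_le[OF cl2]) (simp add: g_def norm_divide norm_mult)
  have g0: "g $ 0 = 0" by (simp add: g_def)
  have g1: "summable (\<lambda>n. cmod (g $ n))"
    by (rule summable_of_summable_sq_weighted[OF g2])
  from T obtain J :: nat and a d \<epsilon> \<rho> where eps: "\<epsilon> > 0" and \<rho>: "\<rho> \<in> weighted_l2 (1/2 + \<epsilon>)"
    and G: "\<forall>n\<ge>1. distr_fourier_coeff (gauge_transform u) (int n)
      = (\<Sum>j=1..J. d j * exp (- \<i> * of_nat n * of_real (a j)) / of_nat n) + \<rho> n"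
    unfolding Talbot_admissible_def by (elim conjE exE) (rule that)
  have coeff: "distr_fourier_coeff (gauge_transform u) (int n)
      = \<i> * of_nat n * (\<Sum>k. (fps_exp (- \<i>) oo g) $ (n + k) * cnj ((fps_exp \<i> oo g) $ k))" for n
    using gauge_transform_coeff[of u n] g1 by (simp only: g_def c_def)
  have "summable (\<lambda>n. (real n powr (1 + s)
      * cmod (\<Sum>k. (fps_exp (- \<i>) oo g) $ (n + k) * cnj ((fps_exp \<i> oo g) $ k)))\<^sup>2)"
    by (rule Talbot_profile_weighted_l2[OF s eps \<rho>]) (use G coeff in simp)
  then have "summable (\<lambda>n. (real n powr (1 + s) * cmod (g $ n))\<^sup>2)"
    by (rule regularity_from_projection[OF g0 g2 s])
  then show ?thesis unfolding ng c_def by (rule Sobolev_r0I[OF u s(1)])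
qed

theorem proposition1p3:
  fixes u0 :: "real \<Rightarrow> real"
  assumes "u0 \<in> L2_r0" and "Talbot_admissible u0"
  shows "(\<forall>s. 0 \<le> s \<and> s < 1/2 \<longrightarrow> u0 \<in> Sobolev_r0 s) \<and> u0 \<in> Sobolev_half_minus_r0"
  using Talbot_admissible_imp_Sobolev[OF assms(2)] by (auto simp: Sobolev_half_minus_r0_def)

end
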